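(* For a topological space $X$ the following conditions are equivalent: (a) $X$ is locally indiscrete. (b) Every subset of $X$ is preopen. (c) Every singleton in $X$ is preopen. (d) Every closed subset of $X$ is preopen. (e) Every locally closed subset of $X$ is open. (f) Every locally closed subset of $X$ is closed. (g) The closure of every locally closed subset of $X$ is open. (h) Every dense open subset of $X$ is regular open.
   Context: No separation axioms are assumed. A space is locally indiscrete if every open set is closed (equivalently, every closed set is open). A subset $A$ of $X$ is preopen if $A\subseteq \mathrm{int}(\mathrm{cl}(A))$, and regular open if $A=\mathrm{int}(\mathrm{cl}(A))$. A subset $A$ of $X$ is locally closed if for every $x\in A$ there is an open set $U\subseteq X$ such that $x\in U$ and $A\cap U$ is closed in $U$ (equivalently, $A$ is the intersection of an open set and a closed set). *)

theory Defs
  imports "HOL-Analysis.Abstract_Topology"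
begin

definition locally_indiscrete :: "'a topology \<Rightarrow> bool" where
  "locally_indiscrete X \<longleftrightarrow> (\<forall>U. openin X U \<longrightarrow> closedin X U)"

definition preopen_in :: "'a topology \<Rightarrow> 'a set \<Rightarrow> bool" where
  "preopen_in X A \<longleftrightarrow> A \<subseteq> topspace X \<and> A \<subseteq> X interior_of (X closure_of A)"

definition regular_open_in :: "'a topology \<Rightarrow> 'a set \<Rightarrow> bool" where
  "regular_open_in X A \<longleftrightarrow> A = X interior_of (X closure_of A)"

definition locally_closed_in :: "'a topology \<Rightarrow> 'a set \<Rightarrow> bool" where
  "locally_closed_in X A \<longleftrightarrow>
     A \<subseteq> topspace X \<and>
     (\<forall>x\<in>A. \<exists>U. openin X U \<and> x \<in> U \<and> closedin (subtopology X U) (A \<inter> U))"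

definition dense_in :: "'a topology \<Rightarrow> 'a set \<Rightarrow> bool" where
  "dense_in X A \<longleftrightarrow> A \<subseteq> topspace X \<and> X closure_of A = topspace X"

end

theory Submission
  imports Defs
begin

text \<open>
  Taking complements, local indiscreteness also says that every closed set is open, so that open,
  closed and clopen sets coincide. This makes each condition immediate: a closure is open, and a
  locally closed set is a union of relatively closed, hence open, pieces.

  For the converses, closed sets and open sets are both locally closed, and a closed set that is
  preopen equals its interior; these facts settle every condition about closed or locally closed
  sets. The two remaining arguments have more content. If singletons are preopen, then a point \<open>x\<close>
  adherent to an open set \<open>U\<close> has a neighbourhood all of whose points are adherent to \<open>{x}\<close>, and a
  common point of it with \<open>U\<close> pulls \<open>x\<close> into \<open>U\<close>
  (\<open>locally_indiscrete_if_singletons_preopen\<close>). If dense open sets are regular open, then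
  the whole space is the only dense open set, and this applies to
  the union of an open set with its exterior (\<open>locally_indiscrete_if_dense_open_regular\<close>).
\<close>

lemma locally_indiscrete_iff_closedin_imp_openin:
  "locally_indiscrete X \<longleftrightarrow> (\<forall>A. closedin X A \<longrightarrow> openin X A)"
proof
  assume *: "locally_indiscrete X"
  show "\<forall>A. closedin X A \<longrightarrow> openin X A"
  proof (intro allI impI)
    fix A assume A: "closedin X A"
    have "closedin X (topspace X - A)"
      using * openin_diff[OF openin_topspace A] unfolding locally_indiscrete_def by blast
    then have "openin X (topspace X - (topspace X - A))"
      by (rule openin_diff[OF openin_topspace])
    then show "openin X A"
      by (simp only: double_diff[OF closedin_subset[OF A] subset_refl])
  qed
next
  assume *: "\<forall>A. closedin X A \<longrightarrow> openin X A"
  show "locally_indiscrete X"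
    unfolding locally_indiscrete_def
  proof (intro allI impI)
    fix U assume U: "openin X U"
    have "openin X (topspace X - U)"
      using * closedin_diff[OF closedin_topspace U] by blast
    then show "closedin X U"
      using openin_subset[OF U] by (simp add: closedin_def)
  qed
qed

lemma closedin_imp_locally_closed_in:
  assumes "closedin X A"
  shows "locally_closed_in X A"
  unfolding locally_closed_in_def
proof (intro conjI ballI)
  show "A \<subseteq> topspace X"
    using assms by (rule closedin_subset)
  fix x assume "x \<in> A"
  then show "\<exists>U. openin X U \<and> x \<in> U \<and> closedin (subtopology X U) (A \<inter> U)"
    using assms closedin_subset[OF assms]
    by (intro exI[of _ "topspace X"]) (auto simp: inf.absorb1 subtopology_topspace)
qed

text \<open>Around a point of an open set, the set itself is a neighbourhood in which it is everything.\<close>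

lemma openin_imp_locally_closed_in:
  assumes "openin X A"
  shows "locally_closed_in X A"
proof -
  have "closedin (subtopology X A) (A \<inter> A)"
    using closedin_topspace[of "subtopology X A"] openin_subset[OF assms]
    by (simp add: inf.absorb2)
  then show ?thesis
    using assms openin_subset[OF assms] unfolding locally_closed_in_def by blast
qed

lemma locally_indiscrete_imp_preopen_in:
  assumes "locally_indiscrete X" "A \<subseteq> topspace X"
  shows "preopen_in X A"
proof -
  have "openin X (X closure_of A)"
    using assms(1) by (simp add: locally_indiscrete_iff_closedin_imp_openin)
  then show ?thesis
    using assms(2) by (simp add: preopen_in_def interior_of_openin closure_of_subset)
qed

text \<open>
  The trace of a locally closed set on a witnessing neighbourhood is the intersection of an open set
  with a closed one, hence open here; the set is the union of these traces.
\<close>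

lemma locally_indiscrete_imp_openin_locally_closed:
  assumes "locally_indiscrete X" "locally_closed_in X A"
  shows "openin X A"
proof (subst openin_subopen, intro ballI)
  fix x assume "x \<in> A"
  then obtain U where U: "openin X U" "x \<in> U" "closedin (subtopology X U) (A \<inter> U)"
    using assms(2) by (auto simp: locally_closed_in_def)
  then obtain C where "closedin X C" "A \<inter> U = C \<inter> U"
    by (auto simp: closedin_subtopology)
  then have "openin X (A \<inter> U)"
    using assms(1) U(1) by (auto simp: locally_indiscrete_iff_closedin_imp_openin)
  then show "\<exists>T. openin X T \<and> x \<in> T \<and> T \<subseteq> A"
    using \<open>x \<in> A\<close> U(2) by blast
qed

text \<open>
  Let \<open>x\<close> be adherent to an open set \<open>U\<close>. The interior of the closure of \<open>{x}\<close> is a neighbourhood of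
  \<open>x\<close>, so it meets \<open>U\<close> in some \<open>y\<close>. Now \<open>y\<close> is adherent to \<open>{x}\<close> and \<open>U\<close> is a neighbourhood of \<open>y\<close>,
  which forces \<open>x\<close> into \<open>U\<close>.
\<close>

lemma locally_indiscrete_if_singletons_preopen:
  assumes "\<forall>x\<in>topspace X. preopen_in X {x}"
  shows "locally_indiscrete X"
  unfolding locally_indiscrete_def
proof (intro allI impI)
  fix U assume U: "openin X U"
  have "x \<in> U" if x: "x \<in> X closure_of U" for x
  proof -
    let ?V = "X interior_of (X closure_of {x})"
    have "x \<in> ?V"
      using assms x by (auto simp: preopen_in_def in_closure_of)
    then obtain y where "y \<in> U" "y \<in> ?V"
      using x openin_interior_of unfolding in_closure_of by blast
    then have "y \<in> X closure_of {x}"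
      using interior_of_subset by (metis subsetD)
    with U \<open>y \<in> U\<close> show "x \<in> U"
      by (auto simp: in_closure_of)
  qed
  then show "closedin X U"
    using closure_of_subset_eq[of U X] openin_subset[OF U] by blast
qed

lemma closedin_preopen_in_imp_openin:
  assumes "closedin X A" "preopen_in X A"
  shows "openin X A"
  using assms by (simp add: preopen_in_def closure_of_closedin flip: subset_interior_of_eq)

lemma dense_in_regular_open_in_imp_eq_topspace:
  assumes "dense_in X A" "regular_open_in X A"
  shows "A = topspace X"
  using assms by (simp add: dense_in_def regular_open_in_def)

text \<open>
  An open set together with its exterior is open and misses only the frontier of the set, which has
  no interior. So this union is dense, and it can be the whole space only if the frontier is empty.
\<close>

lemma locally_indiscrete_if_dense_open_regular:
  assumes "\<forall>A. dense_in X A \<and> openin X A \<longrightarrow> regular_open_in X A"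
  shows "locally_indiscrete X"
  unfolding locally_indiscrete_def
proof (intro allI impI)
  fix U assume U: "openin X U"
  let ?D = "U \<union> (topspace X - X closure_of U)"
  have "openin X ?D"
    using U by (simp add: openin_Un openin_diff)
  moreover have "dense_in X ?D"
  proof -
    have "topspace X - X closure_of U \<subseteq> X closure_of (topspace X - X closure_of U)"
      by (simp add: closure_of_subset)
    then have "X closure_of ?D = topspace X"
      using closure_of_subset_topspace[of X] by (auto simp: closure_of_Un)
    then show ?thesis
      using openin_subset[OF U] by (auto simp: dense_in_def)
  qed
  ultimately have "?D = topspace X"
    using assms dense_in_regular_open_in_imp_eq_topspace by blast
  then have "X closure_of U \<subseteq> U"
    using closure_of_subset_topspace[of X U] by blast
  then show "closedin X U"
    using closure_of_subset_eq[of U X] openin_subset[OF U] by blast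
qed

lemma locally_indiscrete_imp_regular_open_in:
  assumes "locally_indiscrete X" "openin X A"
  shows "regular_open_in X A"
  using assms
  by (simp add: locally_indiscrete_def regular_open_in_def closure_of_closedin interior_of_openin)

theorem proposition3p1:
  fixes X :: "'a topology"
  shows "(locally_indiscrete X \<longleftrightarrow> (\<forall>A. A \<subseteq> topspace X \<longrightarrow> preopen_in X A))
       \<and> (locally_indiscrete X \<longleftrightarrow> (\<forall>x\<in>topspace X. preopen_in X {x}))
       \<and> (locally_indiscrete X \<longleftrightarrow> (\<forall>A. closedin X A \<longrightarrow> preopen_in X A))
       \<and> (locally_indiscrete X \<longleftrightarrow> (\<forall>A. locally_closed_in X A \<longrightarrow> openin X A))
       \<and> (locally_indiscrete X \<longleftrightarrow> (\<forall>A. locally_closed_in X A \<longrightarrow> closedin X A))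
       \<and> (locally_indiscrete X \<longleftrightarrow> (\<forall>A. locally_closed_in X A \<longrightarrow> openin X (X closure_of A)))
       \<and> (locally_indiscrete X \<longleftrightarrow> (\<forall>A. dense_in X A \<and> openin X A \<longrightarrow> regular_open_in X A))"
proof (intro conjI iffI)
  have closed_open: "locally_indiscrete X" if "\<And>A. closedin X A \<Longrightarrow> openin X A"
    using that by (simp add: locally_indiscrete_iff_closedin_imp_openin)
  {
    assume *: "locally_indiscrete X"
    show "\<forall>A. A \<subseteq> topspace X \<longrightarrow> preopen_in X A"
      by (simp add: locally_indiscrete_imp_preopen_in[OF *])
    show "\<forall>x\<in>topspace X. preopen_in X {x}"
      by (simp add: locally_indiscrete_imp_preopen_in[OF *])
    show "\<forall>A. closedin X A \<longrightarrow> preopen_in X A"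
      by (simp add: locally_indiscrete_imp_preopen_in[OF *] closedin_subset)
    show "\<forall>A. locally_closed_in X A \<longrightarrow> openin X A"
      by (simp add: locally_indiscrete_imp_openin_locally_closed[OF *])
    then show "\<forall>A. locally_closed_in X A \<longrightarrow> closedin X A"
      using * by (simp add: locally_indiscrete_def)
    show "\<forall>A. locally_closed_in X A \<longrightarrow> openin X (X closure_of A)"
      using * by (simp add: locally_indiscrete_iff_closedin_imp_openin)
    show "\<forall>A. dense_in X A \<and> openin X A \<longrightarrow> regular_open_in X A"
      by (simp add: locally_indiscrete_imp_regular_open_in[OF *])
  }
  show "locally_indiscrete X" if "\<forall>A. A \<subseteq> topspace X \<longrightarrow> preopen_in X A"
    using that by (intro locally_indiscrete_if_singletons_preopen) simp
  show "locally_indiscrete X" if "\<forall>x\<in>topspace X. preopen_in X {x}"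
    using that by (rule locally_indiscrete_if_singletons_preopen)
  show "locally_indiscrete X" if "\<forall>A. closedin X A \<longrightarrow> preopen_in X A"
    using that by (simp add: closed_open closedin_preopen_in_imp_openin)
  show "locally_indiscrete X" if "\<forall>A. locally_closed_in X A \<longrightarrow> openin X A"
    using that by (simp add: closed_open closedin_imp_locally_closed_in)
  show "locally_indiscrete X" if "\<forall>A. locally_closed_in X A \<longrightarrow> closedin X A"
    using that by (simp add: locally_indiscrete_def openin_imp_locally_closed_in)
  show "locally_indiscrete X" if *: "\<forall>A. locally_closed_in X A \<longrightarrow> openin X (X closure_of A)"
  proof (rule closed_open)
    fix A assume A: "closedin X A"
    then have "openin X (X closure_of A)"
      using * by (simp add: closedin_imp_locally_closed_in)
    with A show "openin X A"
      by (simp add: closure_of_closedin)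
  qed
  show "locally_indiscrete X" if "\<forall>A. dense_in X A \<and> openin X A \<longrightarrow> regular_open_in X A"
    using that by (rule locally_indiscrete_if_dense_open_regular)
qed

end
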